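(* The slot complexity of any Monte Carlo algorithm which detects collision with high probability in the beeping model $BL$ is $\Omega(\log n)$, where $n$ is the number of nodes of the graph (worst case over graphs with $n$ nodes).
   Context: Beeping model: the network is a finite simple undirected graph; nodes are anonymous (a node's behaviour depends only on its initial state, its independent random choices and what it hears), run the same randomised algorithm, and start in the same slot. In each synchronous slot every active node either beeps or listens. In $BL$, a beeping node gets no information about other beeps in that slot, and a listening node learns only whether at least one neighbour beeped. Collision detection problem: each node initially is either in a (common) state in which it wishes to beep or in a (common) state in which it does not. A node wishing to beep must decide whether at least one of its neighbours also wishes to beep; a node not wishing to beep must decide whether at least two of its neighbours wish to beep (a collision). A Monte Carlo algorithm detects collision with high probability if the decisions of all nodes are correct with probability $1-o(n^{-1})$. The slot complexity is the number of slots until all nodes have terminated. *)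

theory Defs
  imports "HOL-Probability.Probability" "HOL-Library.Landau_Symbols"
begin

type_synonym network = "nat set \<times> (nat \<times> nat) set"

definition graphs :: "nat \<Rightarrow> network set" where
  "graphs n = {(V, E). finite V \<and> card V = n \<and> E \<subseteq> V \<times> V \<and> sym E \<and> irrefl E}"

text \<open>An input of the collision detection problem: a network together with the set of those of
  its nodes that wish to beep.\<close>

definition inputs :: "nat \<Rightarrow> (network \<times> nat set) set" where
  "inputs n = {((V, E), W). (V, E) \<in> graphs n \<and> W \<subseteq> V}"

text \<open>\<open>Terminate d\<close> is the final decision \<open>d\<close> of a node, which is no longer active from then on.\<close>

datatype action = Beep | Listen | Terminate bool

text \<open>All random choices of a node are given by one sample \<open>r\<close> from the probability space
  \<open>random\<close>; choosing afresh in every slot amounts to taking a sequence space. In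
  \<open>behaviour A w r h\<close>, the flag \<open>w\<close> says whether the node wishes to beep, and \<open>h\<close> lists what the
  node perceived in the slots so far: \<open>None\<close> for a slot in which it beeped, and \<open>Some b\<close> for a
  slot in which it listened, where \<open>b\<close> says whether at least one neighbour beeped.\<close>

record 'r algorithm =
  random :: "'r measure"
  behaviour :: "bool \<Rightarrow> 'r \<Rightarrow> bool option list \<Rightarrow> action"

definition randomised_algorithm :: "'r algorithm \<Rightarrow> bool" where
  "randomised_algorithm A \<longleftrightarrow> prob_space (random A) \<and>
     (\<forall>w h. (\<lambda>r. behaviour A w r h) \<in> random A \<rightarrow>\<^sub>M count_space UNIV)"

text \<open>The perceptions of node \<open>v\<close> before slot \<open>t\<close> (slots are numbered from \<open>0\<close>), where \<open>\<omega>\<close> gives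
  the random choices of the nodes. Since a node that terminates perceives nothing any more, its
  action remains \<open>Terminate d\<close>.\<close>

primrec perceived ::
    "'r algorithm \<Rightarrow> network \<times> nat set \<Rightarrow> (nat \<Rightarrow> 'r) \<Rightarrow> nat \<Rightarrow> nat \<Rightarrow> bool option list" where
  "perceived A I \<omega> 0 = (\<lambda>v. [])"
| "perceived A I \<omega> (Suc t) =
     (let ((V, E), W) = I;
          h = perceived A I \<omega> t;
          a = (\<lambda>v. behaviour A (v \<in> W) (\<omega> v) (h v))
      in (\<lambda>v. case a v of
            Beep \<Rightarrow> h v @ [None]
          | Listen \<Rightarrow> h v @ [Some (\<exists>u. (v, u) \<in> E \<and> a u = Beep)]
          | Terminate d \<Rightarrow> h v))"

definition action_in ::
    "'r algorithm \<Rightarrow> network \<times> nat set \<Rightarrow> (nat \<Rightarrow> 'r) \<Rightarrow> nat \<Rightarrow> nat \<Rightarrow> action" where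
  "action_in A = (\<lambda>((V, E), W) \<omega> t v.
     behaviour A (v \<in> W) (\<omega> v) (perceived A ((V, E), W) \<omega> t v))"

text \<open>The number of slots until all nodes have terminated; it is \<open>\<infinity>\<close> if this never happens.\<close>

definition slots :: "'r algorithm \<Rightarrow> network \<times> nat set \<Rightarrow> (nat \<Rightarrow> 'r) \<Rightarrow> enat" where
  "slots A = (\<lambda>((V, E), W) \<omega>.
     INF t\<in>{t. \<forall>v\<in>V. \<exists>d. action_in A ((V, E), W) \<omega> t v = Terminate d}. enat t)"

definition correct_decision :: "network \<times> nat set \<Rightarrow> nat \<Rightarrow> bool" where
  "correct_decision = (\<lambda>((V, E), W) v.
     if v \<in> W then \<exists>u\<in>W. (v, u) \<in> E else card {u \<in> W. (v, u) \<in> E} \<ge> 2)"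

definition all_correct :: "'r algorithm \<Rightarrow> network \<times> nat set \<Rightarrow> (nat \<Rightarrow> 'r) \<Rightarrow> bool" where
  "all_correct A = (\<lambda>((V, E), W) \<omega>.
     \<forall>v\<in>V. \<exists>t. action_in A ((V, E), W) \<omega> t v = Terminate (correct_decision ((V, E), W) v))"

definition choices :: "'r algorithm \<Rightarrow> network \<times> nat set \<Rightarrow> (nat \<Rightarrow> 'r) measure" where
  "choices A = (\<lambda>((V, E), W). Pi\<^sub>M V (\<lambda>_. random A))"

text \<open>The nodes may know the size \<open>n\<close> of the network, so a family of algorithms indexed by \<open>n\<close> is
  considered; an algorithm that does not use \<open>n\<close> is a constant family.\<close>

definition detects_collision_whp :: "(nat \<Rightarrow> 'r algorithm) \<Rightarrow> bool" where
  "detects_collision_whp A \<longleftrightarrow>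
     (\<exists>\<epsilon> \<in> o(\<lambda>n. 1 / real n). \<forall>n. \<forall>I\<in>inputs n.
        measure (choices (A n) I) {\<omega> \<in> space (choices (A n) I). all_correct (A n) I \<omega>}
          \<ge> 1 - \<epsilon> n)"

text \<open>If the number of slots depends on the random choices, its expectation is taken. The
  expectation is at most the maximum over the random choices, so a lower bound also holds
  for the latter.\<close>

definition slot_complexity :: "(nat \<Rightarrow> 'r algorithm) \<Rightarrow> nat \<Rightarrow> ennreal" where
  "slot_complexity A n =
     (SUP I\<in>inputs n. \<integral>\<^sup>+ \<omega>. ennreal_of_enat (slots (A n) I \<omega>) \<partial>choices (A n) I)"

end

theory Submission
  imports Defs
begin

text \<open>Compare two inputs in which nodes 0 and 1 wish to beep: in one of them the network has no
  edges, in the other these two nodes are adjacent. If in the network without edges both nodes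
  would take the same actions, then in the other network neither of them ever listens while the
  other one beeps, so they take these actions again and decide wrongly in one of the networks. The
  actions in the first \<open>T\<close> slots take at most \<open>4 ^ T\<close> values, so by Cauchy--Schwarz they coincide
  with probability of order at least \<open>4 ^ - T\<close> whenever termination within \<open>T\<close> slots is likely.
  This exceeds \<open>o(1/n)\<close> if \<open>T \<le> ln n / 2\<close>.\<close>

section \<open>Runs without heard beeps, and the two inputs\<close>

text \<open>These are the perceptions of a wishing node to which every listening slot is silent.
  They depend on the sample \<open>r\<close> of this node alone, so the solo runs of different nodes
  are independent and identically distributed.\<close>

primrec solo_perceived :: "'r algorithm \<Rightarrow> 'r \<Rightarrow> nat \<Rightarrow> bool option list" where
  "solo_perceived A r 0 = []"
| "solo_perceived A r (Suc t) =
     (let h = solo_perceived A r t in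
      case behaviour A True r h of
        Beep \<Rightarrow> h @ [None]
      | Listen \<Rightarrow> h @ [Some False]
      | Terminate d \<Rightarrow> h)"

definition solo_action :: "'r algorithm \<Rightarrow> 'r \<Rightarrow> nat \<Rightarrow> action" where
  "solo_action A r t = behaviour A True r (solo_perceived A r t)"

text \<open>The nodes from 2 on only bring the size up to \<open>n\<close>: they have no neighbours
  here or in \<open>adjacent_input\<close>, so they influence neither node 0 nor node 1.\<close>

definition isolated_input :: "nat \<Rightarrow> network \<times> nat set" where
  "isolated_input n = (({..<n}, {}), {0, 1})"

definition adjacent_input :: "nat \<Rightarrow> network \<times> nat set" where
  "adjacent_input n = (({..<n}, {(0, 1), (1, 0)}), {0, 1})"

lemma inputs_isolated_input: "n \<ge> 2 \<Longrightarrow> isolated_input n \<in> inputs n"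
  by (auto simp: isolated_input_def inputs_def graphs_def sym_def irrefl_def)

lemma inputs_adjacent_input: "n \<ge> 2 \<Longrightarrow> adjacent_input n \<in> inputs n"
  by (auto simp: adjacent_input_def inputs_def graphs_def sym_def irrefl_def)

lemma choices_isolated_input: "choices A (isolated_input n) = Pi\<^sub>M {..<n} (\<lambda>_. random A)"
  by (simp add: choices_def isolated_input_def)

lemma choices_adjacent_input: "choices A (adjacent_input n) = Pi\<^sub>M {..<n} (\<lambda>_. random A)"
  by (simp add: choices_def adjacent_input_def)

section \<open>Comparison of actual runs with solo runs\<close>

lemma action_in_isolated_input:
  "action_in A (isolated_input n) \<omega> t 0 = solo_action A (\<omega> 0) t"
proof -
  have "perceived A (isolated_input n) \<omega> t 0 = solo_perceived A (\<omega> 0) t"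
    by (induction t) (auto simp: isolated_input_def Let_def split: action.split)
  then show ?thesis
    by (simp add: action_in_def solo_action_def isolated_input_def)
qed

text \<open>The induction treats both nodes at once. As long as both have perceived what they would
  perceive alone, they act alike; hence whenever one listens, so does the other, and the slot is
  silent for both.\<close>

lemma action_in_adjacent_input:
  assumes "\<And>t. solo_action A (\<omega> 0) t = solo_action A (\<omega> 1) t"
  shows "action_in A (adjacent_input n) \<omega> t 0 = solo_action A (\<omega> 0) t"
proof -
  have "perceived A (adjacent_input n) \<omega> t 0 = solo_perceived A (\<omega> 0) t \<and>
        perceived A (adjacent_input n) \<omega> t 1 = solo_perceived A (\<omega> 1) t"
  proof (induction t)
    case (Suc t)
    then show ?case
      using assms[of t]
      by (auto simp: adjacent_input_def solo_action_def Let_def split: action.split)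
  qed (simp add: adjacent_input_def)
  then show ?thesis
    by (simp add: action_in_def solo_action_def adjacent_input_def)
qed

lemma solo_action_terminated:
  assumes "solo_action A r t = Terminate d" "t \<le> t'"
  shows "solo_action A r t' = Terminate d"
  using assms(2)
proof (induction t' rule: dec_induct)
  case (step m)
  then show ?case by (simp add: solo_action_def)
qed (use assms(1) in simp)

lemma not_all_correct_adjacent_input:
  assumes "n \<ge> 2"
    and "solo_action A (\<omega> 0) T = Terminate False" "solo_action A (\<omega> 1) T = Terminate False"
    and "\<And>t. t < T \<Longrightarrow> solo_action A (\<omega> 0) t = solo_action A (\<omega> 1) t"
  shows "\<not> all_correct A (adjacent_input n) \<omega>"
proof
  \<comment> \<open>From slot \<open>T\<close> on both actions stay \<open>Terminate False\<close>,
    so agreement in the first \<open>T\<close> slots gives agreement forever.\<close>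
  have eq: "solo_action A (\<omega> 0) t = solo_action A (\<omega> 1) t" for t
    using assms solo_action_terminated by (metis linorder_not_less)
  assume correct: "all_correct A (adjacent_input n) \<omega>"
  have decision: "correct_decision (adjacent_input n) 0"
    by (simp add: correct_decision_def adjacent_input_def)
  obtain t where "action_in A (adjacent_input n) \<omega> t 0 = Terminate True"
    using correct assms(1) decision
    by (force simp: all_correct_def adjacent_input_def dest: bspec[of _ _ 0])
  then have "solo_action A (\<omega> 0) t = Terminate True"
    using action_in_adjacent_input[OF eq] by simp
  then show False
    using assms(2) solo_action_terminated
    by (metis action.inject linorder_le_cases)
qed

text \<open>Node 0 has no neighbour, so the right decision is \<open>False\<close>, and a decision
  never changes once it is taken.\<close>

lemma all_correct_isolated_inputD:
  assumes "n \<ge> 2" and correct: "all_correct A (isolated_input n) \<omega>"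
    and "solo_action A (\<omega> 0) T = Terminate d"
  shows "\<not> d"
proof -
  have decision: "\<not> correct_decision (isolated_input n) 0"
    by (simp add: correct_decision_def isolated_input_def)
  obtain t where "action_in A (isolated_input n) \<omega> t 0 = Terminate False"
    using correct assms(1) decision
    by (force simp: all_correct_def isolated_input_def dest: bspec[of _ _ 0])
  then have "solo_action A (\<omega> 0) t = Terminate False"
    by (simp add: action_in_isolated_input)
  then show ?thesis
    using assms(3) solo_action_terminated
    by (metis action.inject linorder_le_cases)
qed

text \<open>Termination is permanent, so if node 0 is still active in slot \<open>T\<close>, no
  earlier slot belongs to the set whose infimum is \<open>slots\<close>.\<close>

lemma slots_isolated_input_ge:
  assumes "n \<ge> 2" "\<And>d. solo_action A (\<omega> 0) T \<noteq> Terminate d"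
  shows "slots A (isolated_input n) \<omega> \<ge> enat T"
proof -
  have "T \<le> t" if "\<forall>v<n. \<exists>d. action_in A (isolated_input n) \<omega> t v = Terminate d" for t
  proof -
    have "\<exists>d. action_in A (isolated_input n) \<omega> t 0 = Terminate d"
      using that assms(1) by auto
    then obtain d where "solo_action A (\<omega> 0) t = Terminate d"
      by (auto simp: action_in_isolated_input)
    then show ?thesis
      using assms(2) solo_action_terminated nat_le_linear by metis
  qed
  then show ?thesis
    by (auto simp: slots_def isolated_input_def intro!: INF_greatest)
qed

section \<open>Measurability of solo runs\<close>

text \<open>Histories form a countable type, so measurability of \<open>behaviour\<close> at each
  fixed history carries over to a random history.\<close>

lemma measurable_solo_perceived:
  assumes "randomised_algorithm A"
  shows "(\<lambda>r. solo_perceived A r t) \<in> random A \<rightarrow>\<^sub>M count_space UNIV"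
proof (induction t)
  case (Suc t)
  have "(\<lambda>r. case behaviour A True r h of
      Beep \<Rightarrow> h @ [None] | Listen \<Rightarrow> h @ [Some False] | Terminate d \<Rightarrow> h)
      \<in> random A \<rightarrow>\<^sub>M count_space UNIV" for h
    by (rule measurable_compose[where N = "count_space UNIV" and f = "\<lambda>r. behaviour A True r h"])
      (use assms in \<open>simp_all add: randomised_algorithm_def\<close>)
  from measurable_compose_countable[OF this Suc] show ?case
    by (simp add: Let_def)
qed simp

lemma measurable_solo_action:
  assumes "randomised_algorithm A"
  shows "(\<lambda>r. solo_action A r t) \<in> random A \<rightarrow>\<^sub>M count_space UNIV"
proof -
  have "(\<lambda>r. behaviour A True r h) \<in> random A \<rightarrow>\<^sub>M count_space UNIV" for h
    using assms by (auto simp: randomised_algorithm_def)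
  from measurable_compose_countable[OF this measurable_solo_perceived[OF assms]] show ?thesis
    by (simp add: solo_action_def)
qed

lemma sets_solo_action:
  assumes "randomised_algorithm A"
  shows "{r \<in> space (random A). solo_action A r t \<in> S} \<in> sets (random A)"
  using measurable_sets[OF measurable_solo_action[OF assms], of S]
  by (simp add: vimage_def Int_def conj_commute)

lemma UNIV_action: "(UNIV :: action set) = {Beep, Listen, Terminate True, Terminate False}"
proof -
  have "x \<in> {Beep, Listen, Terminate True, Terminate False}" for x
    by (cases x) auto
  then show ?thesis by blast
qed

lemma finite_UNIV_action: "finite (UNIV :: action set)"
  by (simp add: UNIV_action)

lemma card_UNIV_action: "card (UNIV :: action set) = 4"
  by (simp add: UNIV_action)

section \<open>Independent components of a product space\<close>

lemma prob_PiM_component: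
  assumes "prob_space M" "i \<in> I" "X \<in> sets M"
  shows "measure (Pi\<^sub>M I (\<lambda>_. M)) {\<omega> \<in> space (Pi\<^sub>M I (\<lambda>_. M)). \<omega> i \<in> X} = measure M X"
proof -
  interpret prob_space M by fact
  interpret product_prob_space "\<lambda>_. M" I by unfold_locales
  show ?thesis
    using emeasure_PiM_Collect_single[of i X] assms by (simp add: measure_def)
qed

lemma prob_PiM_two_components:
  assumes "prob_space M" "i \<in> I" "j \<in> I" "i \<noteq> j" "X \<in> sets M"
  shows "measure (Pi\<^sub>M I (\<lambda>_. M)) {\<omega> \<in> space (Pi\<^sub>M I (\<lambda>_. M)). \<omega> i \<in> X \<and> \<omega> j \<in> X} = (measure M X)\<^sup>2"
proof -
  interpret prob_space M by fact
  interpret product_prob_space "\<lambda>_. M" I by unfold_locales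
  show ?thesis
    using emeasure_PiM_Collect[of "{i, j}" "\<lambda>_. X"] assms
    by (simp add: measure_def enn2real_mult power2_eq_square)
qed

text \<open>By independence both components fall into \<open>X c\<close> with probability the square
  of that of \<open>X c\<close>, and Cauchy--Schwarz bounds the sum of these squares from
  below.\<close>

lemma prob_two_components_coincide:
  fixes X :: "'c \<Rightarrow> 'a set"
  assumes "prob_space M" "i \<in> I" "j \<in> I" "i \<noteq> j" "finite C"
    and X: "\<And>c. c \<in> C \<Longrightarrow> X c \<in> sets M" "disjoint_family_on X C"
  shows "(measure M (\<Union>c\<in>C. X c))\<^sup>2 \<le> card C *
    measure (Pi\<^sub>M I (\<lambda>_. M)) (\<Union>c\<in>C. {\<omega> \<in> space (Pi\<^sub>M I (\<lambda>_. M)). \<omega> i \<in> X c \<and> \<omega> j \<in> X c})"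
proof -
  interpret prob_space M by fact
  interpret P: product_prob_space "\<lambda>_. M" I by unfold_locales
  let ?S = "\<lambda>c. {\<omega> \<in> space (Pi\<^sub>M I (\<lambda>_. M)). \<omega> i \<in> X c \<and> \<omega> j \<in> X c}"
  have S: "?S c \<in> sets (Pi\<^sub>M I (\<lambda>_. M))" if "c \<in> C" for c
    using X(1)[OF that] assms(2,3) by measurable
  have "disjoint_family_on ?S C"
    using X(2) by (auto simp: disjoint_family_on_def)
  then have "measure (Pi\<^sub>M I (\<lambda>_. M)) (\<Union>c\<in>C. ?S c) = (\<Sum>c\<in>C. measure (Pi\<^sub>M I (\<lambda>_. M)) (?S c))"
    using S assms(5) by (intro P.finite_measure_finite_Union) auto
  also have "\<dots> = (\<Sum>c\<in>C. (measure M (X c))\<^sup>2)"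
    by (intro sum.cong refl prob_PiM_two_components assms X)
  finally have "measure (Pi\<^sub>M I (\<lambda>_. M)) (\<Union>c\<in>C. ?S c) = (\<Sum>c\<in>C. (measure M (X c))\<^sup>2)" .
  moreover have "measure M (\<Union>c\<in>C. X c) = (\<Sum>c\<in>C. measure M (X c))"
    using X assms(5) by (intro finite_measure_finite_Union) auto
  moreover have "(\<Sum>c\<in>C. measure M (X c))\<^sup>2 \<le> card C * (\<Sum>c\<in>C. (measure M (X c))\<^sup>2)"
    using sum_squared_le_sum_of_squares[of "\<lambda>c. measure M (X c)" C] assms(5)
    by (cases "C = {}") (auto simp: divide_simps mult.commute)
  ultimately show ?thesis by simp
qed

section \<open>Probabilities of decisions and of late termination\<close>

text \<open>If nodes 0 and 1 both decide \<open>False\<close> by slot \<open>T\<close> after the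
  same solo actions, then some decision in the adjacent network is wrong. So this coincidence has
  probability at most \<epsilon>, whereas Cauchy--Schwarz over the \<open>4 ^ T\<close> action
  sequences makes it at least the left-hand side divided by \<open>4 ^ T\<close>.\<close>

lemma prob_decide_False_le:
  assumes A: "randomised_algorithm A" and n: "n \<ge> 2" and "\<epsilon> < 1"
    and correct: "measure (choices A (adjacent_input n))
      {\<omega> \<in> space (choices A (adjacent_input n)). all_correct A (adjacent_input n) \<omega>} \<ge> 1 - \<epsilon>"
  shows "(measure (random A) {r \<in> space (random A). solo_action A r T = Terminate False})\<^sup>2
    \<le> 4 ^ T * \<epsilon>"
proof -
  let ?M = "random A"
  let ?P = "Pi\<^sub>M {..<n} (\<lambda>_. ?M)"
  let ?C = "{..<T} \<rightarrow>\<^sub>E (UNIV :: action set)"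
  let ?D = "{r \<in> space ?M. solo_action A r T = Terminate False}"
  \<comment> \<open>The event \<open>?D\<close> is split according to the sequence \<open>c\<close>
    of the first \<open>T\<close> solo actions; \<open>?S\<close> says that nodes 0 and 1 lie in the
    same piece.\<close>
  define X where "X c = {r \<in> space ?M. solo_action A r T = Terminate False \<and>
    (\<forall>t\<in>{..<T}. solo_action A r t = c t)}" for c
  let ?S = "\<Union>c\<in>?C. {\<omega> \<in> space ?P. \<omega> 0 \<in> X c \<and> \<omega> 1 \<in> X c}"
  let ?G = "{\<omega> \<in> space ?P. all_correct A (adjacent_input n) \<omega>}"
  have M: "prob_space ?M"
    using A by (simp add: randomised_algorithm_def)
  interpret P: prob_space ?P
    by (intro prob_space_PiM M)
  note [measurable] = measurable_solo_action[OF A]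
  have X: "X c \<in> sets ?M" for c
    unfolding X_def by measurable
  have "disjoint_family_on X ?C"
  proof -
    have "c = d" if "c \<in> ?C" "d \<in> ?C" "r \<in> X c" "r \<in> X d" for c d r
      using that by (intro PiE_ext[OF that(1,2)]) (simp add: X_def)
    then show ?thesis
      unfolding disjoint_family_on_def by blast
  qed
  moreover have "(\<Union>c\<in>?C. X c) = ?D"
  proof -
    have "r \<in> X (restrict (solo_action A r) {..<T})" if "r \<in> ?D" for r
      using that by (auto simp: X_def)
    then have "?D \<subseteq> (\<Union>c\<in>?C. X c)"
      by (metis (no_types, lifting) UNIV_I UN_I restrict_PiE_iff subsetI)
    then show ?thesis
      by (auto simp: X_def)
  qed
  moreover have fin: "finite ?C"
    by (intro finite_PiE finite_UNIV_action) auto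
  moreover have "card ?C = 4 ^ T"
    by (simp add: card_PiE card_UNIV_action)
  ultimately have le: "(measure ?M ?D)\<^sup>2 \<le> 4 ^ T * measure ?P ?S"
    using prob_two_components_coincide[OF M, of 0 "{..<n}" 1 ?C X] X n by simp
  have "measure ?P ?G \<ge> 1 - \<epsilon>"
    using correct by (simp add: choices_adjacent_input)
  \<comment> \<open>A set of positive measure is measurable, since \<open>measure\<close> is 0 on all other sets.\<close>
  moreover from this have G: "?G \<in> sets ?P"
    using \<open>\<epsilon> < 1\<close> measure_notin_sets[of ?G ?P] by fastforce
  moreover have S: "?S \<in> sets ?P"
  proof -
    have [measurable]: "(\<lambda>\<omega>. \<omega> 0) \<in> ?P \<rightarrow>\<^sub>M ?M" "(\<lambda>\<omega>. \<omega> 1) \<in> ?P \<rightarrow>\<^sub>M ?M"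
      using n by simp_all
    have "{\<omega> \<in> space ?P. \<omega> 0 \<in> X c \<and> \<omega> 1 \<in> X c} \<in> sets ?P" for c
      using X[of c] by measurable
    then show ?thesis
      using fin by auto
  qed
  moreover have "?G \<inter> ?S = {}"
  proof -
    have "\<not> all_correct A (adjacent_input n) \<omega>" if "\<omega> 0 \<in> X c" "\<omega> 1 \<in> X c" for \<omega> c
      using that by (intro not_all_correct_adjacent_input[OF n, where T = T]) (auto simp: X_def)
    then show ?thesis by blast
  qed
  ultimately have "measure ?P ?S \<le> \<epsilon>"
    using P.finite_measure_Union[of ?G ?S] P.prob_le_1[of "?G \<union> ?S"] by linarith
  then show ?thesis
    using le by (meson mult_left_mono order_trans zero_le_numeral zero_le_power)
qed

text \<open>When all decisions in the network without edges are correct, node 0 has either decided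
  \<open>False\<close> by slot \<open>T\<close> or not terminated yet; the union bound does the
  rest.\<close>

lemma prob_decide_False_ge:
  assumes A: "randomised_algorithm A" and n: "n \<ge> 2"
    and correct: "measure (choices A (isolated_input n))
      {\<omega> \<in> space (choices A (isolated_input n)). all_correct A (isolated_input n) \<omega>} \<ge> 1 - \<epsilon>"
  shows "measure (random A) {r \<in> space (random A). solo_action A r T = Terminate False}
    \<ge> 1 - \<epsilon> - measure (random A) {r \<in> space (random A). solo_action A r T \<notin> range Terminate}"
proof -
  let ?M = "random A"
  let ?P = "Pi\<^sub>M {..<n} (\<lambda>_. ?M)"
  let ?D = "{r \<in> space ?M. solo_action A r T = Terminate False}"
  let ?B = "{r \<in> space ?M. solo_action A r T \<notin> range Terminate}"
  let ?G = "{\<omega> \<in> space ?P. all_correct A (isolated_input n) \<omega>}"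
  let ?D' = "{\<omega> \<in> space ?P. \<omega> 0 \<in> ?D}" and ?B' = "{\<omega> \<in> space ?P. \<omega> 0 \<in> ?B}"
  have M: "prob_space ?M"
    using A by (simp add: randomised_algorithm_def)
  interpret P: prob_space ?P
    by (intro prob_space_PiM M)
  have DB: "?D \<in> sets ?M" "?B \<in> sets ?M"
    using sets_solo_action[OF A, of T "{Terminate False}"] sets_solo_action[OF A, of T "- range Terminate"]
    by simp_all
  have proj: "(\<lambda>\<omega>. \<omega> 0) \<in> ?P \<rightarrow>\<^sub>M ?M"
    using n by simp
  have meas: "?D' \<in> sets ?P" "?B' \<in> sets ?P"
    using DB proj by measurable
  have "?G \<subseteq> ?D' \<union> ?B'"
  proof
    fix \<omega> assume \<omega>: "\<omega> \<in> ?G"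
    then have "\<omega> 0 \<in> space ?M"
      using proj by (auto dest: measurable_space)
    moreover have "\<not> d" if "solo_action A (\<omega> 0) T = Terminate d" for d
      using all_correct_isolated_inputD[OF n, of A \<omega> T d] that \<omega> by blast
    ultimately show "\<omega> \<in> ?D' \<union> ?B'"
      using \<omega> by auto
  qed
  \<comment> \<open>Monotonicity asks for measurability of the larger set only; if \<open>?G\<close>
    is not measurable, its measure is 0.\<close>
  then have "measure ?P ?G \<le> measure ?P (?D' \<union> ?B')"
    using meas by (intro P.finite_measure_mono) auto
  also have "\<dots> \<le> measure ?P ?D' + measure ?P ?B'"
    using meas by (intro measure_Un_le)
  also have "\<dots> = measure ?M ?D + measure ?M ?B"
    using prob_PiM_component[OF M _ DB(1), of 0 "{..<n}"]
      prob_PiM_component[OF M _ DB(2), of 0 "{..<n}"] n by simp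
  finally show ?thesis
    using correct by (simp add: choices_isolated_input)
qed

text \<open>This is Markov's inequality: \<open>slots\<close> is at least \<open>T\<close> on the
  event that node 0 is still active in slot \<open>T\<close>.\<close>

lemma nn_integral_slots_isolated_input_ge:
  assumes A: "randomised_algorithm A" and n: "n \<ge> 2"
  shows "(\<integral>\<^sup>+ \<omega>. ennreal_of_enat (slots A (isolated_input n) \<omega>) \<partial>choices A (isolated_input n))
    \<ge> ennreal (T * measure (random A) {r \<in> space (random A). solo_action A r T \<notin> range Terminate})"
proof -
  let ?M = "random A"
  let ?P = "Pi\<^sub>M {..<n} (\<lambda>_. ?M)"
  let ?B = "{r \<in> space ?M. solo_action A r T \<notin> range Terminate}"
  let ?B' = "{\<omega> \<in> space ?P. \<omega> 0 \<in> ?B}"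
  have M: "prob_space ?M"
    using A by (simp add: randomised_algorithm_def)
  interpret P: prob_space ?P
    by (intro prob_space_PiM M)
  have B: "?B \<in> sets ?M"
    using sets_solo_action[OF A, of T "- range Terminate"] by simp
  moreover have "(\<lambda>\<omega>. \<omega> 0) \<in> ?P \<rightarrow>\<^sub>M ?M"
    using n by simp
  ultimately have "?B' \<in> sets ?P"
    by measurable
  then have "ennreal (T * measure ?M ?B) = (\<integral>\<^sup>+ \<omega>. of_nat T * indicator ?B' \<omega> \<partial>?P)"
    using prob_PiM_component[OF M _ B, of 0 "{..<n}"] n
    by (simp add: nn_integral_cmult_indicator P.emeasure_eq_measure ennreal_mult
        ennreal_of_nat_eq_real_of_nat)
  also have "\<dots> \<le> (\<integral>\<^sup>+ \<omega>. ennreal_of_enat (slots A (isolated_input n) \<omega>) \<partial>?P)"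
  proof (intro nn_integral_mono)
    fix \<omega>
    show "of_nat T * indicator ?B' \<omega> \<le> ennreal_of_enat (slots A (isolated_input n) \<omega>)"
    proof (cases "\<omega> \<in> ?B'")
      case True
      then have "enat T \<le> slots A (isolated_input n) \<omega>"
        by (intro slots_isolated_input_ge[OF n]) auto
      then have "ennreal_of_enat (enat T) \<le> ennreal_of_enat (slots A (isolated_input n) \<omega>)"
        by (simp only: ennreal_of_enat_le_iff)
      then show ?thesis
        using True by simp
    qed simp
  qed
  finally show ?thesis
    by (simp add: choices_isolated_input)
qed

section \<open>Choice of constants and the asymptotic bound\<close>

text \<open>If node 0 had terminated by slot \<open>T\<close> with probability more than 1/2, it
  would have decided \<open>False\<close> with probability at least 1/4. The square 1/16 would then
  be at most \<open>4 ^ T * \<epsilon>\<close>, hence at most 1/17; the constant 17 is chosen just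
  above 16.\<close>

lemma slot_complexity_ge:
  assumes A: "randomised_algorithm (A n)" and n: "n \<ge> 2"
    and \<epsilon>: "\<epsilon> \<le> 1 / (17 * real n)"
    and correct: "\<And>I. I \<in> inputs n \<Longrightarrow>
      measure (choices (A n) I) {\<omega> \<in> space (choices (A n) I). all_correct (A n) I \<omega>} \<ge> 1 - \<epsilon>"
    and T: "4 ^ T \<le> real n"
  shows "slot_complexity A n \<ge> ennreal (T / 2)"
proof -
  let ?M = "random (A n)"
  let ?D = "{r \<in> space ?M. solo_action (A n) r T = Terminate False}"
  let ?B = "{r \<in> space ?M. solo_action (A n) r T \<notin> range Terminate}"
  have "1 / (17 * real n) \<le> 1 / 34"
    using n by (simp add: divide_simps)
  \<comment> \<open>This gives both \<epsilon> < 1 and 1 - \<epsilon> - 1/2 \<ge> 1/4.\<close>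
  with \<epsilon> have \<epsilon>': "\<epsilon> \<le> 1 / 34" by simp
  have "measure ?M ?B \<ge> 1 / 2"
  proof (rule ccontr)
    assume "\<not> ?thesis"
    then have "measure ?M ?D \<ge> 1 / 4"
      using prob_decide_False_ge[OF A n correct[OF inputs_isolated_input[OF n]], of T] \<epsilon>'
      by linarith
    then have "(1 / 4)\<^sup>2 \<le> (measure ?M ?D)\<^sup>2"
      by (intro power_mono) auto
    also have "\<dots> \<le> 4 ^ T * \<epsilon>"
      using prob_decide_False_le[OF A n _ correct[OF inputs_adjacent_input[OF n]]] \<epsilon>' by simp
    also have "\<dots> \<le> 4 ^ T * (1 / (17 * real n))"
      using \<epsilon> by (intro mult_left_mono) auto
    also have "\<dots> \<le> real n * (1 / (17 * real n))"
      using T by (intro mult_right_mono) auto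
    also have "\<dots> = 1 / 17"
      using n by simp
    finally show False by (simp add: power2_eq_square)
  qed
  then have "real T * (1 / 2) \<le> T * measure ?M ?B"
    by (intro mult_left_mono) auto
  then have "ennreal (T / 2) \<le> ennreal (T * measure ?M ?B)"
    by (intro ennreal_leI) simp
  also have "\<dots> \<le> (\<integral>\<^sup>+ \<omega>. ennreal_of_enat (slots (A n) (isolated_input n) \<omega>)
      \<partial>choices (A n) (isolated_input n))"
    by (rule nn_integral_slots_isolated_input_ge[OF A n])
  also have "\<dots> \<le> slot_complexity A n"
    unfolding slot_complexity_def by (rule SUP_upper) (rule inputs_isolated_input[OF n])
  finally show ?thesis .
qed

theorem corollary2:
  fixes A :: "nat \<Rightarrow> 'r algorithm"
  assumes "\<And>n. randomised_algorithm (A n)"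
    and "detects_collision_whp A"
  shows "\<exists>c>0. \<forall>\<^sub>F n in sequentially. slot_complexity A n \<ge> ennreal (c * ln (real n))"
proof -
  obtain \<epsilon> where \<epsilon>: "\<epsilon> \<in> o(\<lambda>n. 1 / real n)"
    and correct: "\<And>n I. I \<in> inputs n \<Longrightarrow>
      measure (choices (A n) I) {\<omega> \<in> space (choices (A n) I). all_correct (A n) I \<omega>} \<ge> 1 - \<epsilon> n"
    using assms(2) unfolding detects_collision_whp_def by blast
  have "\<forall>\<^sub>F n in sequentially. norm (\<epsilon> n) \<le> 1 / 17 * norm (1 / real n)"
    using landau_o.smallD[OF \<epsilon>, of "1 / 17"] by simp
  \<comment> \<open>From 4 on, rounding \<open>ln (real n) / 2\<close> down loses at most half of
    it.\<close>
  moreover have "\<forall>\<^sub>F n in sequentially. ln (real n) \<ge> 4"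
    using filterlim_compose[OF ln_at_top filterlim_real_sequentially]
    by (simp add: filterlim_at_top)
  moreover have "\<forall>\<^sub>F n in sequentially. n \<ge> (2 :: nat)"
    by (rule eventually_ge_at_top)
  ultimately have "\<forall>\<^sub>F n in sequentially. slot_complexity A n \<ge> ennreal (1 / 8 * ln (real n))"
  proof eventually_elim
    case (elim n)
    define T where "T = nat \<lfloor>ln (real n) / 2\<rfloor>"
    have T: "real T \<le> ln (real n) / 2" "ln (real n) / 4 \<le> real T"
      using elim(2) by (auto simp: T_def) linarith+
    \<comment> \<open>Since 2 \<le> e, \<open>4 ^ T\<close> is at most
      \<open>exp (2 * real T)\<close>, which the choice of \<open>T\<close> keeps below or equal to
      \<open>n\<close>.\<close>
    have "(4 :: real) \<le> exp 1 ^ 2"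
      using exp_ge_add_one_self[of 1] power_mono[of 2 "exp 1 :: real" 2] by simp
    then have "(4 :: real) ^ T \<le> (exp 1 ^ 2) ^ T"
      by (intro power_mono) auto
    also have "\<dots> = exp (2 * real T)"
      by (simp add: exp_of_nat_mult flip: power_mult exp_of_nat_mult)
    also have "\<dots> \<le> exp (ln (real n))"
      using T(1) by simp
    also have "\<dots> = real n"
      using elim(3) by simp
    finally have "slot_complexity A n \<ge> ennreal (T / 2)"
      using elim(1,3) by (intro slot_complexity_ge[OF assms(1) _ _ correct]) auto
    \<comment> \<open>The factor 1/8 combines 1/4 from rounding \<open>T\<close> with 1/2 from the
      probability of late termination.\<close>
    moreover have "ennreal (1 / 8 * ln (real n)) \<le> ennreal (T / 2)"
      using T(2) by (intro ennreal_leI) simp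
    ultimately show ?case
      by (rule order_trans[rotated])
  qed
  then show ?thesis
    by (intro exI[of _ "1 / 8"]) simp
qed

end
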